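(* Let $W\subset V\otimes\mathbb{R}^\ell$ be a geometric space, let $\alpha=-\kappa'(1)/\log m$, where $\alpha\in(0,1)$, and let $\varphi\colon W\to V$ be a linear operator. Suppose there is a constant $C$ such that $$\int_{\mathbb{T}}\big|\mathbb{I}_\alpha[F]\big|\,d\nu\;\leq\; C\,\Big(\sup_{n\geq 0,\ \omega\in \mathcal{AF}_n} m^{(1-\alpha)n}\nu(\omega)\Big)\,\|F\|_{L_1}$$ for every simple martingale $F\in\mathbb{W}$ and every finite non-negative Borel measure $\nu$ on $\mathbb{T}$ for which the supremum is finite. Then $\varphi$ is a canceling operator.
   Context: Fix integers $m\geq 2$, $\ell\geq 1$. $\mathbb{T}$ is the space of sequences $\gamma=(\gamma(0),\gamma(1),\dots)$ with digits in $\{1,\dots,m\}$ (product topology). $\mathcal{AF}_n$ is the set of atoms of level $n$: the $m^n$ cylinder sets obtained by prescribing the first $n$ digits ($\mathcal{AF}_0=\{\mathbb{T}\}$). The $j$-th kid $\omega_j\in\mathcal{AF}_{n+1}$ of $\omega\in\mathcal{AF}_n$ is obtained by prescribing the next digit to be $j$. $\mathcal{F}_n$ is the finite algebra generated by $\mathcal{AF}_n$; $\mathbb{T}$ carries the probability measure giving mass $m^{-n}$ to each atom of level $n$, and $\mathbb{E}$ is the expectation. Martingales $F=\{F_n\}_{n\ge0}$ are adapted to $\{\mathcal F_n\}$; $dF_{n+1}=F_{n+1}-F_n$; $\|F\|_{L_1}=\sup_n\mathbb{E}|F_n|$; $F$ is simple if $F_n=F_N$ for all $n\ge N$, for some $N$.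 The paper works with simple martingales. $V=\{v\in\mathbb{R}^m:\sum_j v_j=0\}$; $V\otimes\mathbb{R}^\ell$ is identified with $\{(w_1,\dots,w_m)\in(\mathbb{R}^\ell)^m:\sum_j w_j=0\}$, and $v\otimes a=(v_1a,\dots,v_ma)$. For $\omega\in\mathcal{AF}_n$ let $dF_{n+1}[\omega]\in V\otimes\mathbb{R}^\ell$ be the string of values of $dF_{n+1}$ on the kids $\omega_1,\dots,\omega_m$. For a linear subspace $W\subset V\otimes\mathbb{R}^\ell$, $\mathbb{W}$ is the set of $\mathbb{R}^\ell$-valued martingales $F$ with $\|F\|_{L_1}<\infty$ and $dF_{n+1}[\omega]\in W$ for all $n\geq0$, $\omega\in\mathcal{AF}_n$. For a linear $\varphi\colon W\to V$, $$\mathbb{I}_\alpha[F]=\sum_{n\ge0}m^{-\alpha n}\sum_{\omega\in\mathcal{AF}_n}\sum_{j=1}^m\big(\varphi(dF_{n+1}[\omega])\big)_j\,\chi_{\omega_j}.$$ Let $\mathbb{M}^W=\{v\in V: v_j\ge-1\ \forall j,\ \exists a\in\mathbb{R}^\ell\setminus\{0\}\text{ with }v\otimes a\in W\}$. For $v\in V$ put $\kappa_v(\theta)=\theta\log\big(\frac1m\sum_{j=1}^m|1+v_j|^{1/\theta}\big)$ for $\theta\in(0,1]$ and $\kappa_v(0)=\log\max_j|1+v_j|$; put $\kappa(\theta)=\sup_{v\in\mathbb{M}^W}\kappa_v(\theta)$, $\theta\in[0,1]$; $\kappa'(1)$ is the left derivative. $W$ is geometric if $\kappa$ is affine on $[0,1]$.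 For a geometric $W$ with $\alpha=-\kappa'(1)/\log m$, a vector $v\otimes a\in W$ with $v\in\mathbb{M}^W$, $a\neq0$ is extremal if $\frac1m\sum_j(1+v_j)\log(1+v_j)=\alpha\log m$ (with $0\log0=0$); its support is $H=\{j:1+v_j\ne0\}$. (Then $1+v_j=m^\alpha$ for $j\in H$.) $\varphi$ is canceling if $(\varphi[v\otimes a])_j=0$ for every $j\in H$, for every extremal $v\otimes a$ with support $H$. *)

theory Defs
  imports "HOL-Probability.Probability"
begin

text \<open>
  The digits are the elements of a finite type \<^typ>\<open>'m\<close> with \<open>m = CARD('m)\<close>, so that sequences of
  digits are functions \<^typ>\<open>nat \<Rightarrow> 'm\<close>. The string space \<open>(\<real>\<^sup>\<ell>)\<^sup>m\<close> is \<open>(real ^ 'l) ^ 'm\<close>.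
\<close>

subsection \<open>The space of sequences\<close>

definition cantor_topology :: "(nat \<Rightarrow> 'm::finite) topology" where
  "cantor_topology = product_topology (\<lambda>_. discrete_topology UNIV) UNIV"

definition cantor_borel :: "(nat \<Rightarrow> 'm::finite) measure" where
  "cantor_borel = sigma UNIV {U. openin cantor_topology U}"

definition atoms :: "nat \<Rightarrow> (nat \<Rightarrow> 'm::finite) set set" where
  "atoms n = range (\<lambda>\<gamma>. {\<gamma>'. \<forall>i<n. \<gamma>' i = \<gamma> i})"

definition kid :: "nat \<Rightarrow> (nat \<Rightarrow> 'm::finite) set \<Rightarrow> 'm \<Rightarrow> (nat \<Rightarrow> 'm) set" where
  "kid n \<omega> j = {\<gamma> \<in> \<omega>. \<gamma> n = j}"

definition atom_algebra :: "nat \<Rightarrow> (nat \<Rightarrow> 'm::finite) measure" where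
  "atom_algebra n = sigma UNIV (atoms n)"

definition uniform_cantor :: "(nat \<Rightarrow> 'm::finite) measure" where
  "uniform_cantor = PiM UNIV (\<lambda>_. uniform_count_measure UNIV)"

lemma atom_PiE:
  "{\<gamma>'::nat \<Rightarrow> 'm::finite. \<forall>i<n. \<gamma>' i = \<gamma> i} = PiE UNIV (\<lambda>i. if i < n then {\<gamma> i} else UNIV)"
  by (auto simp: PiE_def Pi_def split: if_splits)

lemma openin_atom: "\<omega> \<in> atoms n \<Longrightarrow> openin cantor_topology \<omega>"
proof -
  assume "\<omega> \<in> atoms n"
  then obtain \<gamma> where w: "\<omega> = {\<gamma>'. \<forall>i<n. \<gamma>' i = \<gamma> i}" by (auto simp: atoms_def)
  have "finite {i. (if i < n then {\<gamma> i} else UNIV) \<noteq> UNIV}"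
    by (rule finite_subset[of _ "{..<n}"]) auto
  then show ?thesis
    unfolding w atom_PiE cantor_topology_def
    by (subst openin_PiE_gen) auto
qed

lemma finite_atoms: "finite (atoms n :: (nat \<Rightarrow> 'm::finite) set set)"
proof -
  have "atoms n \<subseteq> (\<lambda>s. {\<gamma>'::nat \<Rightarrow> 'm. \<forall>i<n. \<gamma>' i = s i}) ` PiE {..<n} (\<lambda>_. UNIV)"
  proof
    fix \<omega> :: "(nat \<Rightarrow> 'm) set" assume "\<omega> \<in> atoms n"
    then obtain \<gamma> where w: "\<omega> = {\<gamma>'. \<forall>i<n. \<gamma>' i = \<gamma> i}" by (auto simp: atoms_def)
    have "restrict \<gamma> {..<n} \<in> PiE {..<n} (\<lambda>_. UNIV)" by auto
    moreover have "\<omega> = {\<gamma>'. \<forall>i<n. \<gamma>' i = restrict \<gamma> {..<n} i}" unfolding w by auto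
    ultimately show "\<omega> \<in> (\<lambda>s. {\<gamma>'::nat \<Rightarrow> 'm. \<forall>i<n. \<gamma>' i = s i}) ` PiE {..<n} (\<lambda>_. UNIV)" by blast
  qed
  then show ?thesis by (rule finite_subset) (intro finite_imageI finite_PiE, auto)
qed

lemma open_Union_atoms:
  assumes "openin cantor_topology (U :: (nat \<Rightarrow> 'm::finite) set)"
  shows "U = \<Union>{\<omega>. (\<exists>n. \<omega> \<in> atoms n) \<and> \<omega> \<subseteq> U}"
proof
  show "U \<subseteq> \<Union>{\<omega>. (\<exists>n. \<omega> \<in> atoms n) \<and> \<omega> \<subseteq> U}"
  proof
    fix \<gamma> assume "\<gamma> \<in> U"
    then obtain X where X: "finite {i. X i \<noteq> UNIV}" "\<gamma> \<in> PiE UNIV X" "PiE UNIV X \<subseteq> U"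
      using assms unfolding cantor_topology_def openin_product_topology_alt by auto
    obtain n where n: "{i. X i \<noteq> UNIV} \<subseteq> {..<n}"
      using finite_nat_iff_bounded X(1) by blast
    have "{\<gamma>'. \<forall>i<n. \<gamma>' i = \<gamma> i} \<subseteq> PiE UNIV X"
    proof
      fix \<gamma>' assume *: "\<gamma>' \<in> {\<gamma>'. \<forall>i<n. \<gamma>' i = \<gamma> i}"
      have "\<gamma>' i \<in> X i" for i
      proof (cases "i < n")
        case True then show ?thesis using * X(2) by auto
      next
        case False then have "X i = UNIV" using n by auto
        then show ?thesis by simp
      qed
      then show "\<gamma>' \<in> PiE UNIV X" by auto
    qed
    then show "\<gamma> \<in> \<Union>{\<omega>. (\<exists>n. \<omega> \<in> atoms n) \<and> \<omega> \<subseteq> U}"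
      using X(3) by (intro UnionI[of "{\<gamma>'. \<forall>i<n. \<gamma>' i = \<gamma> i}"]) (auto simp: atoms_def)
  qed
qed auto

lemma sets_uniform_cantor: "sets (uniform_cantor :: (nat \<Rightarrow> 'm::finite) measure) = sets cantor_borel"
proof
  have "{{f \<in> Pi\<^sub>E UNIV (\<lambda>_::nat. UNIV :: 'm set). f i \<in> A} |i A. True}
      \<subseteq> sets (cantor_borel :: (nat \<Rightarrow> 'm) measure)"
  proof clarsimp
    fix i and A :: "'m set"
    have "{f::nat \<Rightarrow> 'm. f i \<in> A} = PiE UNIV (\<lambda>k. if k = i then A else UNIV)"
      by (auto simp: PiE_def Pi_def split: if_splits)
    moreover have "finite {k. (if k = i then A else UNIV) \<noteq> UNIV}"
      by (rule finite_subset[of _ "{i}"]) auto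
    ultimately have "openin cantor_topology {f::nat \<Rightarrow> 'm. f i \<in> A}"
      unfolding cantor_topology_def by (simp only:) (subst openin_PiE_gen, auto)
    then show "{f::nat \<Rightarrow> 'm. f i \<in> A} \<in> sets cantor_borel"
      by (auto simp: cantor_borel_def)
  qed
  then show "sets (uniform_cantor :: (nat \<Rightarrow> 'm) measure) \<subseteq> sets cantor_borel"
    unfolding uniform_cantor_def sets_PiM_single
    by (intro sets.sigma_sets_subset')
       (auto simp: space_uniform_count_measure sets_uniform_count_measure cantor_borel_def)
next
  have atom: "\<omega> \<in> sets uniform_cantor" if "\<omega> \<in> atoms n" for n and \<omega> :: "(nat \<Rightarrow> 'm) set"
  proof -
    obtain \<gamma> where w: "\<omega> = {\<gamma>'. \<forall>i<n. \<gamma>' i = \<gamma> i}" using \<open>\<omega> \<in> atoms n\<close> by (auto simp: atoms_def)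
    show ?thesis
      unfolding w atom_PiE uniform_cantor_def
      by (rule sets_PiM_I_countable) (auto simp: sets_uniform_count_measure)
  qed
  have "countable {\<omega> :: (nat \<Rightarrow> 'm) set. \<exists>n. \<omega> \<in> atoms n}"
  proof -
    have "{\<omega> :: (nat \<Rightarrow> 'm) set. \<exists>n. \<omega> \<in> atoms n} = (\<Union>n. atoms n)" by auto
    moreover have "countable (\<Union>n. atoms n :: (nat \<Rightarrow> 'm) set set)"
      by (rule countable_UN[OF _ countable_finite[OF finite_atoms]]) simp
    ultimately show ?thesis by simp
  qed
  then have "{U. openin cantor_topology U} \<subseteq> sets (uniform_cantor :: (nat \<Rightarrow> 'm) measure)"
  proof (intro subsetI)
    fix U :: "(nat \<Rightarrow> 'm) set" assume "U \<in> {U. openin cantor_topology U}"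
    then have U: "U = \<Union>{\<omega>. (\<exists>n. \<omega> \<in> atoms n) \<and> \<omega> \<subseteq> U}" by (intro open_Union_atoms) simp
    have "countable {\<omega>. (\<exists>n. \<omega> \<in> atoms n) \<and> \<omega> \<subseteq> U}"
      by (rule countable_subset[OF _ \<open>countable {\<omega>. \<exists>n. \<omega> \<in> atoms n}\<close>]) blast
    then have "\<Union>{\<omega>. (\<exists>n. \<omega> \<in> atoms n) \<and> \<omega> \<subseteq> U} \<in> sets uniform_cantor"
      by (rule sets.countable_Union) (blast intro: atom)
    then show "U \<in> sets uniform_cantor" using U by simp
  qed
  moreover have sp: "space uniform_cantor = (UNIV :: (nat \<Rightarrow> 'm) set)"
    by (simp add: uniform_cantor_def space_PiM space_uniform_count_measure)
  ultimately have "sigma_sets UNIV {U. openin cantor_topology U}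
      \<subseteq> sets (uniform_cantor :: (nat \<Rightarrow> 'm) measure)"
    using sets.sigma_sets_subset[of "{U. openin cantor_topology U}" "uniform_cantor :: (nat \<Rightarrow> 'm) measure"]
    by simp
  then show "sets cantor_borel \<subseteq> sets (uniform_cantor :: (nat \<Rightarrow> 'm) measure)"
    by (simp add: cantor_borel_def)
qed

lemma emeasure_uniform_cantor_atom:
  fixes \<omega> :: "(nat \<Rightarrow> 'm::finite) set"
  assumes "\<omega> \<in> atoms n"
  shows "emeasure uniform_cantor \<omega> = ennreal ((1 / real CARD('m)) ^ n)"
proof -
  obtain \<gamma> where w: "\<omega> = {\<gamma>'. \<forall>i<n. \<gamma>' i = \<gamma> i}" using assms by (auto simp: atoms_def)
  let ?M = "\<lambda>_::nat. uniform_count_measure (UNIV :: 'm set)"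
  have emb: "\<omega> = prod_emb UNIV ?M {..<n} (PiE {..<n} (\<lambda>i. {\<gamma> i}))"
    unfolding w by (rule set_eqI) (simp add: prod_emb_def PiE_iff space_uniform_count_measure Ball_def)
  have prob: "prob_space (?M i)" for i by (intro prob_space_uniform_count_measure) auto
  have "emeasure uniform_cantor \<omega> = (\<Prod>i<n. emeasure (?M i) {\<gamma> i})"
    unfolding emb uniform_cantor_def
    by (intro emeasure_PiM_emb prob) (simp_all add: sets_uniform_count_measure)
  also have "\<dots> = (\<Prod>i<n. ennreal (1 / real CARD('m)))"
    by (simp add: emeasure_uniform_count_measure)
  finally show ?thesis by (simp add: ennreal_power)
qed

subsection \<open>Martingales\<close>

definition martingale :: "(nat \<Rightarrow> (nat \<Rightarrow> 'm::finite) \<Rightarrow> real ^ 'l) \<Rightarrow> bool" where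
  "martingale F \<longleftrightarrow> (\<forall>n. F n \<in> borel_measurable (atom_algebra n)
     \<and> integrable uniform_cantor (F n)
     \<and> (\<forall>A \<in> sets (atom_algebra n).
          (LINT x:A|uniform_cantor. F (Suc n) x) = (LINT x:A|uniform_cantor. F n x)))"

definition simple_martingale :: "(nat \<Rightarrow> (nat \<Rightarrow> 'm::finite) \<Rightarrow> real ^ 'l) \<Rightarrow> bool" where
  "simple_martingale F \<longleftrightarrow> martingale F \<and> (\<exists>N. \<forall>n\<ge>N. F n = F N)"

definition L1_norm :: "(nat \<Rightarrow> (nat \<Rightarrow> 'm::finite) \<Rightarrow> real ^ 'l) \<Rightarrow> ennreal" where
  "L1_norm F = (SUP n. \<integral>\<^sup>+ x. ennreal (norm (F n x)) \<partial>uniform_cantor)"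

text \<open>
  The function \<open>F (Suc n) - F n\<close> is constant on each kid of an atom of level \<open>n\<close> when \<open>F\<close> is adapted;
  \<^const>\<open>the_elem\<close> applied to the image of the kid is that constant value.
\<close>

definition diff_string ::
    "(nat \<Rightarrow> (nat \<Rightarrow> 'm::finite) \<Rightarrow> real ^ 'l) \<Rightarrow> nat \<Rightarrow> (nat \<Rightarrow> 'm) set \<Rightarrow> (real ^ 'l) ^ 'm" where
  "diff_string F n \<omega> = (\<chi> j. the_elem ((\<lambda>x. F (Suc n) x - F n x) ` kid n \<omega> j))"

subsection \<open>Spaces of strings\<close>

definition V_space :: "(real ^ 'm::finite) set" where
  "V_space = {v. (\<Sum>j\<in>UNIV. v $ j) = 0}"

definition V_tensor :: "((real ^ 'l) ^ 'm::finite) set" where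
  "V_tensor = {w. (\<Sum>j\<in>UNIV. w $ j) = 0}"

definition tensor :: "real ^ 'm \<Rightarrow> real ^ 'l \<Rightarrow> (real ^ 'l) ^ 'm::finite" where
  "tensor v a = (\<chi> j. v $ j *\<^sub>R a)"

definition W_martingales ::
    "((real ^ 'l) ^ 'm::finite) set \<Rightarrow> (nat \<Rightarrow> (nat \<Rightarrow> 'm) \<Rightarrow> real ^ 'l) set" where
  "W_martingales W = {F. martingale F \<and> L1_norm F < \<infinity>
     \<and> (\<forall>n. \<forall>\<omega> \<in> atoms n. diff_string F n \<omega> \<in> W)}"

definition linear_between ::
    "((real ^ 'l) ^ 'm::finite) set \<Rightarrow> (real ^ 'm) set \<Rightarrow> ((real ^ 'l) ^ 'm \<Rightarrow> real ^ 'm) \<Rightarrow> bool" where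
  "linear_between W U \<phi> \<longleftrightarrow> (\<forall>x\<in>W. \<phi> x \<in> U)
     \<and> (\<forall>x\<in>W. \<forall>y\<in>W. \<phi> (x + y) = \<phi> x + \<phi> y)
     \<and> (\<forall>c. \<forall>x\<in>W. \<phi> (c *\<^sub>R x) = c *\<^sub>R \<phi> x)"

text \<open>For a simple martingale only finitely many terms of the series are nonzero.\<close>

definition riesz_potential ::
    "real \<Rightarrow> ((real ^ 'l) ^ 'm::finite \<Rightarrow> real ^ 'm) \<Rightarrow> (nat \<Rightarrow> (nat \<Rightarrow> 'm) \<Rightarrow> real ^ 'l)
      \<Rightarrow> (nat \<Rightarrow> 'm) \<Rightarrow> real" where
  "riesz_potential \<alpha> \<phi> F \<gamma> =
     (\<Sum>n. real CARD('m) powr (- \<alpha> * real n)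
        * (\<Sum>\<omega>\<in>atoms n. \<Sum>j\<in>UNIV. \<phi> (diff_string F n \<omega>) $ j * indicator (kid n \<omega> j) \<gamma>))"

subsection \<open>Geometric spaces and canceling operators\<close>

definition M_set :: "((real ^ 'l) ^ 'm::finite) set \<Rightarrow> (real ^ 'm) set" where
  "M_set W = {v \<in> V_space. (\<forall>j. v $ j \<ge> -1) \<and> (\<exists>a. a \<noteq> 0 \<and> tensor v a \<in> W)}"

definition kappa_vec :: "real ^ 'm::finite \<Rightarrow> real \<Rightarrow> real" where
  "kappa_vec v \<theta> =
     (if \<theta> = 0 then ln (MAX j. \<bar>1 + v $ j\<bar>)
      else \<theta> * ln (1 / real CARD('m) * (\<Sum>j\<in>UNIV. \<bar>1 + v $ j\<bar> powr (1 / \<theta>))))"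

definition kappa :: "((real ^ 'l) ^ 'm::finite) set \<Rightarrow> real \<Rightarrow> real" where
  "kappa W \<theta> = (SUP v\<in>M_set W. kappa_vec v \<theta>)"

text \<open>
  The supremum of reals defining \<^const>\<open>kappa\<close> is that of a nonempty set bounded above, for
  \<open>0 \<le> \<theta> \<le> 1\<close>.
\<close>

lemma M_set_nonempty:
  fixes W :: "((real ^ 'l) ^ 'm::finite) set"
  assumes "subspace W"
  shows "M_set W \<noteq> {}"
proof -
  have "tensor 0 1 = (0 :: (real ^ 'l) ^ 'm)" by (simp add: tensor_def vec_eq_iff)
  moreover have "(1 :: real ^ 'l) \<noteq> 0" by (simp add: vec_eq_iff)
  ultimately have "0 \<in> M_set W"
    using subspace_0[OF assms] unfolding M_set_def V_space_def
    by (auto intro!: exI[of _ "1 :: real ^ 'l"])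
  then show ?thesis by blast
qed

lemma bdd_above_kappa_vec:
  fixes W :: "((real ^ 'l) ^ 'm::finite) set"
  assumes "0 \<le> \<theta>" "\<theta> \<le> 1"
  shows "bdd_above ((\<lambda>v. kappa_vec v \<theta>) ` M_set W)"
proof (rule bdd_aboveI2[where M = "ln (real CARD('m))"])
  fix v assume v: "v \<in> M_set W"
  let ?m = "real CARD('m)"
  have m: "?m \<ge> 1" by (simp add: Suc_le_eq)
  have nn: "1 + v $ j \<ge> 0" for j 
  proof -
    have "v $ j \<ge> -1" using v by (auto simp: M_set_def)
    then show ?thesis by simp
  qed
  have s: "(\<Sum>j\<in>UNIV. 1 + v $ j) = ?m"
    using v by (simp add: M_set_def V_space_def sum.distrib)
  have le: "\<bar>1 + v $ j\<bar> \<le> ?m" for j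
    using member_le_sum[of j UNIV "\<lambda>j. 1 + v $ j"] s nn by simp
  obtain j0 where j0: "1 + v $ j0 > 0"
  proof (rule ccontr)
    assume "\<not> thesis"
    then have "\<And>j. 1 + v $ j \<le> 0" using that by (meson not_le)
    then have "(\<Sum>j\<in>UNIV. 1 + v $ j) \<le> 0" by (intro sum_nonpos)
    then show False using s m by simp
  qed
  show "kappa_vec v \<theta> \<le> ln ?m"
  proof (cases "\<theta> = 0")
    case True
    have "(MAX j. \<bar>1 + v $ j\<bar>) \<ge> \<bar>1 + v $ j0\<bar>" by (rule Max_ge) auto
    moreover have "(MAX j. \<bar>1 + v $ j\<bar>) \<le> ?m" using le by (subst Max_le_iff) auto
    ultimately show ?thesis using True j0 m by (simp add: kappa_vec_def)
  next
    case False
    let ?S = "\<Sum>j\<in>UNIV. \<bar>1 + v $ j\<bar> powr (1 / \<theta>)"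
    have pos: "?S > 0"
      by (rule sum_pos2[of UNIV j0]) (use j0 in auto)
    have "?S \<le> (\<Sum>j\<in>(UNIV::'m set). ?m powr (1 / \<theta>))"
      by (intro sum_mono powr_mono2) (use le assms in auto)
    then have "1 / ?m * ?S \<le> ?m powr (1 / \<theta>)"
      using m by (simp add: field_simps)
    then have "ln (1 / ?m * ?S) \<le> ln (?m powr (1 / \<theta>))"
      using pos m by (subst ln_le_cancel_iff) auto
    then have "\<theta> * ln (1 / ?m * ?S) \<le> \<theta> * ((1 / \<theta>) * ln ?m)"
      using m by (intro mult_left_mono) (use assms in auto)
    then show ?thesis using False by (simp add: kappa_vec_def)
  qed
qed

definition left_deriv :: "(real \<Rightarrow> real) \<Rightarrow> real \<Rightarrow> real" where
  "left_deriv f x = (THE D. (f has_real_derivative D) (at_left x))"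

definition geometric :: "((real ^ 'l) ^ 'm::finite) set \<Rightarrow> bool" where
  "geometric W \<longleftrightarrow> (\<exists>a b. \<forall>\<theta>\<in>{0..1}. kappa W \<theta> = a + b * \<theta>)"

text \<open>
  A string may have several representations \<open>v \<otimes> a\<close>; extremality refers to the pair \<open>(v, a)\<close>. The
  convention \<open>0 log 0 = 0\<close> is automatic.
\<close>

definition extremal ::
    "((real ^ 'l) ^ 'm::finite) set \<Rightarrow> real \<Rightarrow> real ^ 'm \<Rightarrow> real ^ 'l \<Rightarrow> bool" where
  "extremal W \<alpha> v a \<longleftrightarrow> tensor v a \<in> W \<and> v \<in> M_set W \<and> a \<noteq> 0
     \<and> 1 / real CARD('m) * (\<Sum>j\<in>UNIV. (1 + v $ j) * ln (1 + v $ j)) = \<alpha> * ln (real CARD('m))"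

definition support :: "real ^ 'm::finite \<Rightarrow> 'm set" where
  "support v = {j. 1 + v $ j \<noteq> 0}"

definition canceling ::
    "((real ^ 'l) ^ 'm::finite) set \<Rightarrow> real \<Rightarrow> ((real ^ 'l) ^ 'm \<Rightarrow> real ^ 'm) \<Rightarrow> bool" where
  "canceling W \<alpha> \<phi> \<longleftrightarrow> (\<forall>v a. extremal W \<alpha> v a \<longrightarrow> (\<forall>j\<in>support v. \<phi> (tensor v a) $ j = 0))"

end

theory Submission
  imports Defs
begin

text \<open>
  Let \<open>v \<otimes> a\<close> be extremal with support \<open>H\<close> and put \<open>b\<^sub>j = (\<phi>[v \<otimes> a])\<^sub>j\<close>. The hypothesis is tested on
  one measure and a sequence of martingales: \<open>\<nu>\<close> makes the digits independent and uniform on \<open>H\<close>, and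
  \<open>F\<close> is the product martingale \<open>F\<^sub>n(x) = (\<Prod>i<n. 1 + v\<^bsub>x i\<^esub>) a\<close> stopped at time \<open>N\<close>, whose differences
  are multiples of \<open>v \<otimes> a\<close> and whose \<open>L\<^sub>1\<close> norm is \<open>\<bar>a\<bar>\<close> whatever \<open>N\<close> is (\<open>L1_norm_product\<close>).

  Geometricity forces \<open>\<kappa>(\<theta>) = \<alpha> (1 - \<theta>) log m\<close>, because \<open>\<kappa>(1) = 0\<close>. At \<open>\<theta> = 0\<close> this says
  \<open>1 + v\<^sub>j \<le> m\<^sup>\<alpha>\<close> for all \<open>j\<close>, while extremality says that the average of \<open>log (1 + v\<^sub>j)\<close> with weights
  \<open>(1 + v\<^sub>j) / m\<close> is \<open>\<alpha> log m\<close>. An average reaches an upper bound only if every term of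
  positive weight does, so \<open>1 + v\<^sub>j = m\<^sup>\<alpha>\<close> on \<open>H\<close> (\<open>extremal_weight\<close>), and summing over \<open>j\<close> gives \<open>\<bar>H\<bar> = m powr (1 - \<alpha>)\<close>.
  Hence an atom of level \<open>n\<close> has \<open>\<nu>\<close>-measure at most \<open>m powr (- (1 - \<alpha>) n)\<close>, and the supremum in the
  hypothesis is at most \<open>1\<close>.

  On sequences with digits in \<open>H\<close> the size \<open>m powr (\<alpha> n)\<close> of \<open>F\<^sub>n\<close> is cancelled by the factor
  \<open>m powr (- \<alpha> n)\<close> of the potential, so that the potential is the random walk \<open>\<Sum>n<N. b\<^bsub>x n\<^esub>\<close> with independent
  identically distributed steps. The hypothesis bounds its \<open>L\<^sub>1(\<nu>)\<close> norm uniformly in \<open>N\<close>. A random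
  walk with that property does not move (\<open>bounded_random_walk_trivial\<close>), so \<open>b\<close> vanishes on \<open>H\<close>.
\<close>

section \<open>Spaces of digit sequences\<close>

text \<open>
  As there are finitely many atoms of level \<open>n\<close>, the algebra that they generate consists of the sets
  for which membership is decided by the first \<open>n\<close> digits.
\<close>

lemma sets_atom_algebra_iff:
  fixes A :: "(nat \<Rightarrow> 'm::finite) set"
  shows "A \<in> sets (atom_algebra n) \<longleftrightarrow> (\<forall>x\<in>A. \<forall>y. (\<forall>i<n. y i = x i) \<longrightarrow> y \<in> A)"
proof
  assume "A \<in> sets (atom_algebra n)"
  then have "A \<in> sigma_sets UNIV (atoms n)" by (simp add: atom_algebra_def)
  then show "\<forall>x\<in>A. \<forall>y. (\<forall>i<n. y i = x i) \<longrightarrow> y \<in> A"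
  proof induction
    case (Basic A)
    then show ?case by (auto simp: atoms_def)
  next
    case (Compl A)
    then show ?case by (metis DiffD2 DiffI UNIV_I)
  next
    case (Union A)
    then show ?case by blast
  qed simp
next
  assume A: "\<forall>x\<in>A. \<forall>y. (\<forall>i<n. y i = x i) \<longrightarrow> y \<in> A"
  have union: "A = \<Union>{\<omega> \<in> atoms n. \<omega> \<subseteq> A}"
  proof (intro equalityI subsetI)
    fix x assume "x \<in> A"
    then have "{y. \<forall>i<n. y i = x i} \<in> {\<omega> \<in> atoms n. \<omega> \<subseteq> A}" using A by (auto simp: atoms_def)
    then show "x \<in> \<Union>{\<omega> \<in> atoms n. \<omega> \<subseteq> A}" by blast
  qed auto
  have "\<Union>{\<omega> \<in> atoms n. \<omega> \<subseteq> A} \<in> sets (atom_algebra n)"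
    by (rule sets.finite_Union) (auto intro: finite_subset[OF _ finite_atoms] simp: atom_algebra_def)
  then show "A \<in> sets (atom_algebra n)" by (subst union)
qed

lemma sets_atom_algebra_subset:
  "sets (atom_algebra n :: (nat \<Rightarrow> 'm::finite) measure) \<subseteq> sets cantor_borel"
proof -
  have "atoms n \<subseteq> sets (cantor_borel :: (nat \<Rightarrow> 'm) measure)"
    by (auto simp: cantor_borel_def intro!: sigma_sets.Basic openin_atom)
  moreover have "space cantor_borel = (UNIV :: (nat \<Rightarrow> 'm) set)" by (simp add: cantor_borel_def)
  ultimately show ?thesis
    using sets.sigma_sets_subset[of "atoms n" "cantor_borel :: (nat \<Rightarrow> 'm) measure"] by (simp add: atom_algebra_def)
qed

lemma measurable_atom_algebraI:
  fixes f :: "(nat \<Rightarrow> 'm::finite) \<Rightarrow> 'b::topological_space"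
  assumes "\<And>x y. (\<And>i. i < n \<Longrightarrow> y i = x i) \<Longrightarrow> f y = f x"
  shows "f \<in> borel_measurable (atom_algebra n)"
proof (rule measurableI)
  fix B :: "'b set"
  have "space (atom_algebra n :: (nat \<Rightarrow> 'm) measure) = UNIV" by (simp add: atom_algebra_def)
  moreover have "y \<in> f -` B" if "x \<in> f -` B" "\<forall>i<n. y i = x i" for x y
    using that assms[of y x] by simp
  ultimately show "f -` B \<inter> space (atom_algebra n) \<in> sets (atom_algebra n)"
    unfolding sets_atom_algebra_iff by blast
qed simp

text \<open>
  The probability measure \<open>M\<close> is the law of one digit, and \<open>P\<close> makes the digits independent with
  this law. Both the underlying measure of the martingales and the test measure \<open>\<nu>\<close> are of this kind.
\<close>

locale digit_space = prob_space M for M :: "'m::finite measure" +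
  assumes sets_M: "sets M = UNIV"
begin

abbreviation P :: "(nat \<Rightarrow> 'm) measure" where "P \<equiv> PiM UNIV (\<lambda>_. M)"

lemma space_M: "space M = UNIV"
  using sets.sets_into_space[of UNIV M] by (auto simp: sets_M)

lemma integrable_digit:
  fixes g :: "'m \<Rightarrow> 'b::{banach, second_countable_topology}"
  shows "integrable M g"
proof (rule integrable_const_bound[where B = "\<Sum>j\<in>UNIV. norm (g j)"])
  show "AE j in M. norm (g j) \<le> (\<Sum>j\<in>UNIV. norm (g j))"
    by (intro AE_I2 member_le_sum) auto
  show "g \<in> borel_measurable M"
    by (simp add: measurable_def sets_M space_M)
qed

sublocale product_prob_space "\<lambda>_. M" "UNIV :: nat set"
  by unfold_locales

lemma sets_P: "sets P = sets cantor_borel"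
proof -
  have "sets P = sets (uniform_cantor :: (nat \<Rightarrow> 'm) measure)"
    unfolding uniform_cantor_def
    by (intro sets_PiM_cong) (auto simp: sets_M sets_uniform_count_measure)
  then show ?thesis by (simp add: sets_uniform_cantor)
qed

lemma measurable_digit [measurable]: "(\<lambda>x. g (x i)) \<in> borel_measurable P"
proof -
  have "g \<in> borel_measurable M" by (simp add: measurable_def sets_M space_M)
  then show ?thesis by (rule measurable_compose[OF measurable_component_singleton, rotated]) simp
qed

lemma
  fixes g :: "nat \<Rightarrow> 'm \<Rightarrow> 'b::{real_normed_field, banach, second_countable_topology}"
  shows integrable_prod_digits: "integrable P (\<lambda>x. \<Prod>i<n. g i (x i))"
    and integral_prod_digits: "(LINT x|P. (\<Prod>i<n. g i (x i))) = (\<Prod>i<n. (LINT j|M. g i j))"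
proof -
  let ?r = "\<lambda>x::nat \<Rightarrow> 'm. restrict x {..<n}"
  let ?f = "\<lambda>x. \<Prod>i<n. g i (x i)"
  have r: "?r \<in> measurable P (PiM {..<n} (\<lambda>_. M))" by (rule measurable_restrict_subset) simp
  have d: "distr P (PiM {..<n} (\<lambda>_. M)) ?r = PiM {..<n} (\<lambda>_. M)"
    by (rule distr_PiM_restrict_finite) simp_all
  have i: "integrable (PiM {..<n} (\<lambda>_. M)) ?f"
    by (rule product_integrable_prod[where f = g]) (simp_all add: integrable_digit)
  have m: "?f \<in> borel_measurable (PiM {..<n} (\<lambda>_. M))" using i by (rule borel_measurable_integrable)
  have e: "?f (?r x) = ?f x" for x by (intro prod.cong) auto
  show "integrable P ?f"
    using integrable_distr_eq[OF r m] i unfolding d e by simp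
  have "(LINT x|P. ?f x) = (LINT x|PiM {..<n} (\<lambda>_. M). ?f x)"
    using integral_distr[OF r m] unfolding d e by simp
  also have "\<dots> = (\<Prod>i<n. (LINT j|M. g i j))"
    by (rule product_integral_prod[where f = g]) (simp_all add: integrable_digit)
  finally show "(LINT x|P. ?f x) = (\<Prod>i<n. (LINT j|M. g i j))" .
qed

text \<open>
  The digit at position \<open>n\<close> is independent of a function \<open>f\<close> of the first \<open>n\<close> digits. Such an \<open>f\<close> is a
  linear combination of indicators of atoms, and these indicators are products of functions of one
  digit each, to which \<open>integral_prod_digits\<close> applies.
\<close>

lemma integral_mult_next_digit:
  fixes f :: "(nat \<Rightarrow> 'm) \<Rightarrow> real"
  assumes f: "\<And>x y. (\<And>i. i < n \<Longrightarrow> y i = x i) \<Longrightarrow> f y = f x"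
  shows "(LINT x|P. f x * g (x n)) = (LINT x|P. f x) * (LINT j|M. g j)"
proof -
  let ?S = "PiE {..<n} (\<lambda>_. UNIV :: 'm set)"
  let ?h = "\<lambda>s i j. of_bool (j = s i) :: real"
  have fin: "finite ?S" by (intro finite_PiE) auto
  \<comment> \<open>A finite string is represented by its extensional extension to a sequence, so that \<open>f\<close> can be
    evaluated at it.\<close>
  have f_eq: "f x = (\<Sum>s\<in>?S. f s * (\<Prod>i<n. ?h s i (x i)))" for x
  proof -
    have "f s * (\<Prod>i<n. ?h s i (x i)) = (if restrict x {..<n} = s then f s else 0)" if "s \<in> ?S" for s
    proof (cases "restrict x {..<n} = s")
      case True
      then have "(\<Prod>i<n. ?h s i (x i)) = 1" by (intro prod.neutral) auto
      then show ?thesis using True by simp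
    next
      case False
      moreover have "restrict x {..<n} = s" if "\<And>i. i < n \<Longrightarrow> x i = s i"
        by (rule PiE_ext[of _ "{..<n}" "\<lambda>_. UNIV"]) (use that \<open>s \<in> ?S\<close> in auto)
      ultimately obtain i where "i < n" "x i \<noteq> s i" by blast
      then have "(\<Prod>i<n. ?h s i (x i)) = 0" by (intro prod_zero) auto
      then show ?thesis using False by simp
    qed
    then have "(\<Sum>s\<in>?S. f s * (\<Prod>i<n. ?h s i (x i)))
        = (\<Sum>s\<in>?S. if restrict x {..<n} = s then f s else 0)" by (intro sum.cong) auto
    also have "\<dots> = f (restrict x {..<n})" using fin by simp
    also have "\<dots> = f x" by (rule f) auto
    finally show ?thesis by simp
  qed
  have expand: "(LINT x|P. (\<Sum>s\<in>?S. f s * (\<Prod>i<N. c s i (x i))))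
      = (\<Sum>s\<in>?S. f s * (\<Prod>i<N. (LINT j|M. c s i j)))"
    for N and c :: "(nat \<Rightarrow> 'm) \<Rightarrow> nat \<Rightarrow> 'm \<Rightarrow> real"
  proof -
    have "(LINT x|P. (\<Sum>s\<in>?S. f s * (\<Prod>i<N. c s i (x i))))
        = (\<Sum>s\<in>?S. (LINT x|P. f s * (\<Prod>i<N. c s i (x i))))"
      by (rule Bochner_Integration.integral_sum) (intro integrable_mult_right integrable_prod_digits)
    also have "\<dots> = (\<Sum>s\<in>?S. f s * (\<Prod>i<N. (LINT j|M. c s i j)))"
    proof (rule sum.cong[OF refl])
      fix s
      show "(LINT x|P. f s * (\<Prod>i<N. c s i (x i))) = f s * (\<Prod>i<N. (LINT j|M. c s i j))"
        using integral_prod_digits[where g = "c s" and n = N] by simp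
    qed
    finally show ?thesis .
  qed
  let ?k = "\<lambda>s i j. if i < n then ?h s i j else g j"
  have k: "(\<Prod>i<n. ?h s i (x i)) * g (x n) = (\<Prod>i<Suc n. ?k s i (x i))" for s x
    unfolding prod.lessThan_Suc by (intro arg_cong2[where f = times] prod.cong) auto
  have fg: "f x * g (x n) = (\<Sum>s\<in>?S. f s * (\<Prod>i<Suc n. ?k s i (x i)))" for x
    by (simp only: f_eq[of x] sum_distrib_right mult.assoc k)
  have "(LINT x|P. f x * g (x n)) = (LINT x|P. (\<Sum>s\<in>?S. f s * (\<Prod>i<Suc n. ?k s i (x i))))"
    by (rule Bochner_Integration.integral_cong[OF refl fg])
  also have "\<dots> = (\<Sum>s\<in>?S. f s * (\<Prod>i<Suc n. (LINT j|M. ?k s i j)))" by (rule expand)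
  also have "\<dots> = (\<Sum>s\<in>?S. f s * (\<Prod>i<n. (LINT j|M. ?h s i j))) * (LINT j|M. g j)"
    unfolding prod.lessThan_Suc by (simp add: sum_distrib_right mult.assoc)
  also have "(\<Sum>s\<in>?S. f s * (\<Prod>i<n. (LINT j|M. ?h s i j)))
      = (LINT x|P. (\<Sum>s\<in>?S. f s * (\<Prod>i<n. ?h s i (x i))))" by (rule expand[symmetric])
  also have "\<dots> = (LINT x|P. f x)" by (rule Bochner_Integration.integral_cong[OF refl f_eq[symmetric]])
  finally show ?thesis .
qed

lemma emeasure_atom:
  "emeasure P {y. \<forall>i<n. y i = x i} = (\<Prod>i<n. emeasure M {x i})"
proof -
  have "{y. \<forall>i<n. y i = x i} = prod_emb UNIV (\<lambda>_. M) {..<n} (PiE {..<n} (\<lambda>i. {x i}))"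
    by (rule set_eqI) (simp add: prod_emb_def PiE_iff space_M Ball_def)
  then show ?thesis
    by (simp only:) (rule emeasure_PiM_emb, auto simp: sets_M)
qed

end

section \<open>Random walks\<close>

text \<open>
  The circle has no small subgroups, and the same holds for the powers of a complex number:
  \<open>z\<^sup>2 - 1 = (z + 1) (z - 1)\<close>, and \<open>\<bar>z + 1\<bar> \<ge> 3/2\<close> when \<open>z\<close> is within \<open>1/2\<close> of \<open>1\<close>, so each squaring
  multiplies the distance to \<open>1\<close> by at least \<open>3/2\<close>.
\<close>

lemma eq_1_if_powers_near_1:
  fixes z :: complex
  assumes "\<And>n. norm (z ^ n - 1) \<le> 1 / 2"
  shows "z = 1"
proof (rule ccontr)
  assume "z \<noteq> 1"
  have grow: "(3 / 2) ^ k * norm (z - 1) \<le> norm (z ^ (2 ^ k) - 1)" for k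
  proof (induction k)
    case (Suc k)
    let ?u = "z ^ (2 ^ k)"
    have "2 - norm (?u - 1) \<le> norm (?u + 1)"
      using norm_triangle_ineq4[of "?u + 1" "?u - 1"] by simp
    then have "3 / 2 \<le> norm (?u + 1)" using assms[of "2 ^ k"] by simp
    then have "(3 / 2) * ((3 / 2) ^ k * norm (z - 1)) \<le> norm (?u + 1) * norm (?u - 1)"
      by (intro mult_mono Suc.IH) auto
    also have "\<dots> = norm ((?u + 1) * (?u - 1))" by (rule norm_mult[symmetric])
    also have "(?u + 1) * (?u - 1) = z ^ (2 ^ Suc k) - 1"
      by (simp add: mult_2 power_add algebra_simps)
    finally show ?case by (simp add: mult.assoc)
  qed simp
  obtain k where "1 / norm (z - 1) < (3 / 2) ^ k"
    using real_arch_pow[of "3 / 2" "1 / norm (z - 1)"] by auto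
  then have "1 < (3 / 2) ^ k * norm (z - 1)" using \<open>z \<noteq> 1\<close> by (simp add: field_simps)
  then show False using grow[of k] assms[of "2 ^ k"] by linarith
qed

lemma digit_space_pmf: "digit_space (measure_pmf p)"
  by (intro digit_space.intro digit_space_axioms.intro) (auto intro: measure_pmf.prob_space_axioms)

text \<open>
  Let \<open>z\<close> be the characteristic function of one step at \<open>t\<close>. By independence \<open>z\<^sup>N\<close> is that of the position
  after \<open>N\<close> steps, and \<open>\<bar>exp (i y) - 1\<bar> \<le> \<bar>y\<bar>\<close> turns the \<open>L\<^sub>1\<close> bound \<open>K\<close> into \<open>\<bar>z\<^sup>N - 1\<bar> \<le> t K\<close> for all
  \<open>N\<close>. For small \<open>t\<close> this forces \<open>z = 1\<close>, so \<open>cos (t b\<^sub>j) = 1\<close> at every \<open>j\<close> of positive probability.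
  The argument covers walks with and without drift.
\<close>

lemma bounded_random_walk_trivial:
  fixes p :: "'m::finite pmf" and b :: "'m \<Rightarrow> real"
  assumes bound: "\<And>N. (\<integral>\<^sup>+ x. ennreal \<bar>\<Sum>n<N. b (x n)\<bar> \<partial>PiM UNIV (\<lambda>_::nat. measure_pmf p)) \<le> ennreal K"
    and "0 \<le> K" and j: "j \<in> set_pmf p"
  shows "b j = 0"
proof -
  interpret digit_space "measure_pmf p" by (rule digit_space_pmf)
  \<comment> \<open>Chosen so that the powers of \<open>z\<close> stay within \<open>1/2\<close> of \<open>1\<close>, and so that \<open>t b\<^sub>i\<close> can only be
    the zero among the points where the cosine is \<open>1\<close>.\<close>
  define t where "t = 1 / (2 * K + 1 + (\<Sum>j\<in>UNIV. \<bar>b j\<bar>))"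
  have sum_b: "0 \<le> (\<Sum>j\<in>UNIV. \<bar>b j\<bar>)" by (simp add: sum_nonneg)
  then have den: "0 < 2 * K + 1 + (\<Sum>j\<in>UNIV. \<bar>b j\<bar>)" using \<open>0 \<le> K\<close> by linarith
  have t: "0 < t" using den by (simp add: t_def)
  have "2 * K \<le> 2 * K + 1 + (\<Sum>j\<in>UNIV. \<bar>b j\<bar>)"
    using sum_b by linarith
  then have tK: "t * K \<le> 1 / 2"
    using den by (simp add: t_def pos_divide_le_eq)
  have tb: "\<bar>t * b i\<bar> < 1" for i
  proof -
    have "\<bar>b i\<bar> \<le> (\<Sum>j\<in>UNIV. \<bar>b j\<bar>)" by (rule member_le_sum) auto
    then have "\<bar>b i\<bar> < 2 * K + 1 + (\<Sum>j\<in>UNIV. \<bar>b j\<bar>)" using \<open>0 \<le> K\<close> by linarith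
    then show ?thesis using den by (simp add: t_def abs_mult)
  qed
  define e where "e i = exp (\<i> * complex_of_real (t * b i))" for i
  define z where "z = (LINT i|measure_pmf p. e i)"
  have near: "norm (z ^ N - 1) \<le> 1 / 2" for N
  proof -
    let ?S = "\<lambda>x::nat \<Rightarrow> 'm. \<Sum>n<N. b (x n)"
    have exp_S: "(\<Prod>n<N. e (x n)) = exp (\<i> * complex_of_real (t * ?S x))" for x
      by (simp add: e_def exp_sum[symmetric] sum_distrib_left)
    have int: "integrable P (\<lambda>x. \<Prod>n<N. e (x n))" by (rule integrable_prod_digits)
    have "(LINT x|P. (\<Prod>n<N. e (x n))) = z ^ N"
      using integral_prod_digits[where g = "\<lambda>_. e" and n = N] by (simp add: z_def)
    then have "z ^ N - 1 = (LINT x|P. (\<Prod>n<N. e (x n)) - 1)"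
      using int by (simp add: P.prob_space)
    moreover have "integrable P (\<lambda>x. (\<Prod>n<N. e (x n)) - 1)" using int by simp
    ultimately have "ennreal (norm (z ^ N - 1)) \<le> (\<integral>\<^sup>+ x. ennreal (norm ((\<Prod>n<N. e (x n)) - 1)) \<partial>P)"
      by (simp only:) (rule integral_norm_bound_ennreal)
    also have "\<dots> \<le> (\<integral>\<^sup>+ x. ennreal t * ennreal \<bar>?S x\<bar> \<partial>P)"
    proof (rule nn_integral_mono)
      fix x
      have "norm ((\<Prod>n<N. e (x n)) - 1) \<le> t * \<bar>?S x\<bar>"
        unfolding exp_S dist_exp_i_1 using abs_sin_x_le_abs_x[of "t * ?S x / 2"] t
        by (simp add: abs_mult)
      then show "ennreal (norm ((\<Prod>n<N. e (x n)) - 1)) \<le> ennreal t * ennreal \<bar>?S x\<bar>"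
        using t by (simp add: ennreal_mult[symmetric] ennreal_leI)
    qed
    also have "\<dots> = ennreal t * (\<integral>\<^sup>+ x. ennreal \<bar>?S x\<bar> \<partial>P)"
      by (rule nn_integral_cmult) measurable
    also have "\<dots> \<le> ennreal t * ennreal K" by (intro mult_left_mono bound) auto
    also have "\<dots> = ennreal (t * K)" using t \<open>0 \<le> K\<close> by (simp add: ennreal_mult)
    also have "\<dots> \<le> ennreal (1 / 2)" using tK by (rule ennreal_leI)
    finally show ?thesis by (subst (asm) ennreal_le_iff) auto
  qed
  then have "z = 1" by (rule eq_1_if_powers_near_1)
  moreover have "Re z = (\<Sum>i\<in>UNIV. pmf p i * cos (t * b i))"
    unfolding z_def by (subst integral_measure_pmf[of UNIV]) (auto simp: e_def Re_exp)
  ultimately have "(\<Sum>i\<in>UNIV. pmf p i * cos (t * b i)) = (\<Sum>i\<in>UNIV. pmf p i)"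
    by (simp add: sum_pmf_eq_1)
  then have "(\<Sum>i\<in>UNIV. pmf p i * (1 - cos (t * b i))) = 0"
    by (simp add: algebra_simps sum_subtractf)
  then have "pmf p j * (1 - cos (t * b j)) = 0"
    by (subst (asm) sum_nonneg_eq_0_iff) auto
  then have "cos (t * b j) = 1" using j by (simp add: set_pmf_eq)
  then obtain k :: int where k: "t * b j = k * 2 * pi" by (auto simp: cos_one_2pi_int)
  have "k = 0"
  proof (rule ccontr)
    assume "k \<noteq> 0"
    then have "1 \<le> \<bar>real_of_int k\<bar>" by linarith
    then have "1 * 1 \<le> \<bar>real_of_int k\<bar> * (2 * pi)" using pi_gt3 by (intro mult_mono) auto
    then show False using tb[of j] unfolding k by (simp add: abs_mult)
  qed
  then show ?thesis using k t by simp
qed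

section \<open>Extremal vectors of a geometric space\<close>

lemma left_deriv_eqI:
  assumes "(f has_real_derivative D) (at_left x)"
  shows "left_deriv f x = D"
  unfolding left_deriv_def
proof (rule the_equality)
  show "(f has_real_derivative D) (at_left x)" by (rule assms)
  fix D' assume "(f has_real_derivative D') (at_left x)"
  then show "D' = D"
    using assms unfolding has_field_derivative_iff
    by (rule tendsto_unique[rotated]) simp
qed

text \<open>At \<open>\<theta> = 1\<close> the logarithm is taken of the mean of \<open>1 + v\<^sub>j\<close>, which is \<open>1\<close> as \<open>v\<close> has sum zero.\<close>

lemma kappa_1:
  fixes W :: "((real ^ 'l) ^ 'm::finite) set"
  assumes "subspace W"
  shows "kappa W 1 = 0"
proof -
  have "kappa_vec v 1 = 0" if "v \<in> M_set W" for v
  proof -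
    have "\<bar>1 + v $ j\<bar> = 1 + v $ j" for j
    proof -
      have "v $ j \<ge> - 1" using that by (auto simp: M_set_def)
      then show ?thesis by simp
    qed
    moreover have "(\<Sum>j\<in>UNIV. 1 + v $ j) = real CARD('m)"
      using that by (simp add: M_set_def V_space_def sum.distrib)
    ultimately show ?thesis by (simp add: kappa_vec_def)
  qed
  then have "kappa W 1 = (SUP v\<in>M_set W. 0)" by (simp add: kappa_def)
  then show ?thesis using M_set_nonempty[OF assms] by simp
qed

lemma kappa_geometric:
  fixes W :: "((real ^ 'l) ^ 'm::finite) set"
  assumes "subspace W" "geometric W" "0 \<le> \<theta>" "\<theta> \<le> 1"
  shows "kappa W \<theta> = - left_deriv (kappa W) 1 * (1 - \<theta>)"
proof -
  obtain a b where ab: "\<And>\<theta>. \<theta> \<in> {0..1} \<Longrightarrow> kappa W \<theta> = a + b * \<theta>"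
    using assms(2) by (auto simp: geometric_def)
  have "eventually (\<lambda>\<theta>. \<theta> \<in> {0<..<1}) (at_left (1::real))"
    by (rule eventually_at_leftI[of 0]) auto
  then have ev: "eventually (\<lambda>\<theta>. kappa W \<theta> = a + b * \<theta>) (at_left 1)"
    by eventually_elim (use ab in auto)
  have "((\<lambda>\<theta>. a + b * \<theta>) has_real_derivative b) (at_left 1)"
    by (auto intro!: derivative_eq_intros)
  then have "(kappa W has_real_derivative b) (at_left 1)"
    using has_field_derivative_cong_eventually[OF ev] ab[of 1] by auto
  then have "left_deriv (kappa W) 1 = b" by (rule left_deriv_eqI)
  moreover have "a + b = 0" using kappa_1[OF assms(1)] ab[of 1] by simp
  moreover have "kappa W \<theta> = a + b * \<theta>" using ab assms(3,4) by simp
  ultimately show ?thesis by (simp add: algebra_simps)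
qed

text \<open>
  The bound \<open>\<kappa>\<^sub>v(0) \<le> \<kappa>(0)\<close> makes every summand
  \<open>(1 + v\<^sub>i) (\<alpha> log m - log (1 + v\<^sub>i))\<close> nonnegative, and extremality makes their sum zero.
\<close>

lemma extremal_weight:
  fixes W :: "((real ^ 'l) ^ 'm::finite) set"
  assumes "CARD('m) \<ge> 2" "subspace W" "geometric W"
    and \<alpha>: "\<alpha> = - left_deriv (kappa W) 1 / ln (real CARD('m))"
    and ext: "extremal W \<alpha> v a" and j: "j \<in> support v"
  shows "1 + v $ j = real CARD('m) powr \<alpha>"
proof -
  let ?m = "real CARD('m)"
  have m: "?m > 1" using assms(1) by linarith
  then have lnm: "ln ?m > 0" by simp
  have v: "v \<in> M_set W" using ext by (simp add: extremal_def)
  then have "v $ i \<ge> - 1" for i by (auto simp: M_set_def)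
  then have nn: "0 \<le> 1 + v $ i" for i by (smt (verit))
  have sum_m: "(\<Sum>i\<in>UNIV. 1 + v $ i) = ?m"
    using v by (simp add: M_set_def V_space_def sum.distrib)
  have "kappa_vec v 0 \<le> kappa W 0"
    unfolding kappa_def by (rule cSUP_upper[OF v bdd_above_kappa_vec]) auto
  also have "\<dots> = \<alpha> * ln ?m"
    using kappa_geometric[OF assms(2,3), of 0] lnm \<alpha> by simp
  finally have max_le: "ln (MAX i. \<bar>1 + v $ i\<bar>) \<le> \<alpha> * ln ?m" by (simp add: kappa_vec_def)
  have gap: "0 \<le> (1 + v $ i) * (\<alpha> * ln ?m - ln (1 + v $ i))" for i
  proof (cases "1 + v $ i = 0")
    case False
    then have pos: "0 < 1 + v $ i" using nn[of i] by linarith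
    have "1 + v $ i \<le> (MAX i. \<bar>1 + v $ i\<bar>)"
      using nn[of i] by (intro Max_ge) (auto intro: rev_image_eqI[of i])
    then have "ln (1 + v $ i) \<le> ln (MAX i. \<bar>1 + v $ i\<bar>)"
      using pos by (subst ln_le_cancel_iff) auto
    then show ?thesis using pos max_le by (intro mult_nonneg_nonneg) auto
  qed simp
  have "(\<Sum>i\<in>UNIV. (1 + v $ i) * ln (1 + v $ i)) = ?m * (\<alpha> * ln ?m)"
    using ext m by (simp add: extremal_def field_simps)
  moreover have "(\<Sum>i\<in>UNIV. (1 + v $ i) * (\<alpha> * ln ?m)) = ?m * (\<alpha> * ln ?m)"
    by (simp only: sum_distrib_right[symmetric] sum_m)
  ultimately have "(\<Sum>i\<in>UNIV. (1 + v $ i) * (\<alpha> * ln ?m - ln (1 + v $ i))) = 0"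
    by (simp only: right_diff_distrib sum_subtractf)
  then have "(1 + v $ j) * (\<alpha> * ln ?m - ln (1 + v $ j)) = 0"
    using gap by (subst (asm) sum_nonneg_eq_0_iff) auto
  moreover have "1 + v $ j \<noteq> 0" using j by (simp add: support_def)
  ultimately have "ln (1 + v $ j) = \<alpha> * ln ?m" by simp
  then have "exp (ln (1 + v $ j)) = ?m powr \<alpha>" using m by (simp add: powr_def)
  then show ?thesis using nn[of j] \<open>1 + v $ j \<noteq> 0\<close> by simp
qed

lemma card_support_extremal:
  fixes W :: "((real ^ 'l) ^ 'm::finite) set"
  assumes "CARD('m) \<ge> 2" "subspace W" "geometric W"
    and "\<alpha> = - left_deriv (kappa W) 1 / ln (real CARD('m))"
    and "extremal W \<alpha> v a"
  shows "real (card (support v)) = real CARD('m) powr (1 - \<alpha>)"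
proof -
  let ?m = "real CARD('m)"
  have m: "?m > 0" using assms(1) by linarith
  have "?m = (\<Sum>i\<in>UNIV. 1 + v $ i)"
    using assms(5) by (simp add: extremal_def M_set_def V_space_def sum.distrib)
  also have "\<dots> = (\<Sum>i\<in>support v. 1 + v $ i)"
    by (rule sum.mono_neutral_right) (auto simp: support_def)
  also have "\<dots> = (\<Sum>i\<in>support v. ?m powr \<alpha>)"
    by (intro sum.cong extremal_weight[OF assms]) auto
  finally have "?m = card (support v) * ?m powr \<alpha>" by simp
  then show ?thesis using m by (simp add: powr_diff field_simps)
qed

section \<open>Product martingales\<close>

text \<open>The index \<open>N\<close> is the time at which the martingale is stopped, which makes it simple.\<close>

definition product_martingale ::
    "real ^ 'm \<Rightarrow> real ^ 'l \<Rightarrow> nat \<Rightarrow> nat \<Rightarrow> (nat \<Rightarrow> 'm::finite) \<Rightarrow> real ^ 'l" where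
  "product_martingale v a N n x = (\<Prod>i<min n N. 1 + v $ x i) *\<^sub>R a"

lemma digit_space_uniform: "digit_space (uniform_count_measure (UNIV :: 'm::finite set))"
  by (intro digit_space.intro digit_space_axioms.intro prob_space_uniform_count_measure)
     (auto simp: sets_uniform_count_measure)

lemma integral_weight:
  fixes v :: "real ^ 'm::finite"
  assumes "v \<in> V_space"
  shows "(LINT j|uniform_count_measure UNIV. (1 + v $ j)) = 1"
  using assms by (simp add: integral_uniform_count_measure V_space_def sum.distrib)

text \<open>
  Each step multiplies by \<open>1 + v\<^bsub>x n\<^esub>\<close>, which has mean \<open>1\<close> and is independent of the first \<open>n\<close> digits.
\<close>

lemma martingale_product:
  fixes v :: "real ^ 'm::finite" and a :: "real ^ 'l"
  assumes v: "v \<in> V_space"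
  shows "martingale (product_martingale v a N)"
proof -
  interpret digit_space "uniform_count_measure (UNIV :: 'm set)" by (rule digit_space_uniform)
  have P: "P = uniform_cantor" by (simp add: uniform_cantor_def)
  let ?F = "product_martingale v a N"
  let ?G = "\<lambda>n x. \<Prod>i<n. 1 + v $ x i"
  show ?thesis
    unfolding martingale_def
  proof (intro allI conjI ballI)
    fix n
    show "?F n \<in> borel_measurable (atom_algebra n)"
      by (rule measurable_atom_algebraI) (auto simp: product_martingale_def intro!: prod.cong)
    show "integrable uniform_cantor (?F n)"
      unfolding product_martingale_def P[symmetric]
      by (intro integrable_scaleR_left integrable_prod_digits)
    fix A :: "(nat \<Rightarrow> 'm) set" assume A: "A \<in> sets (atom_algebra n)"
    show "(LINT x:A|uniform_cantor. ?F (Suc n) x) = (LINT x:A|uniform_cantor. ?F n x)"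
    proof (cases "n < N")
      case True
      let ?f = "\<lambda>x. indicator A x * ?G n x"
      have A_P: "A \<in> sets P" unfolding sets_P by (rule subsetD[OF sets_atom_algebra_subset A])
      have int: "integrable P (\<lambda>x. indicator A x * ?G k x)" for k
        using integrable_mult_indicator[OF A_P integrable_prod_digits[where g = "\<lambda>_ j. 1 + v $ j" and n = k]]
        unfolding real_scaleR_def .
      have f: "?f y = ?f x" if "\<And>i. i < n \<Longrightarrow> y i = x i" for x y
      proof -
        have "y \<in> A \<longleftrightarrow> x \<in> A" using A that unfolding sets_atom_algebra_iff by metis
        moreover have "?G n y = ?G n x" using that by (intro prod.cong) auto
        ultimately show ?thesis by (simp add: indicator_def)
      qed
      have "(LINT x|P. ?f x * (1 + v $ x n)) = (LINT x|P. ?f x)"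
        using integral_mult_next_digit[of n ?f "\<lambda>j. 1 + v $ j", OF f] integral_weight[OF v] by simp
      then have "(LINT x|P. (?f x * (1 + v $ x n)) *\<^sub>R a) = (LINT x|P. ?f x *\<^sub>R a)"
        using int[of n] int[of "Suc n"] by (simp add: mult.assoc)
      then show ?thesis
        using True
        by (simp add: set_lebesgue_integral_def product_martingale_def min_def P mult.assoc)
    qed (simp add: product_martingale_def min_def)
  qed
qed

text \<open>The factors are nonnegative, so the norm is \<open>\<bar>a\<bar>\<close> times a product of independent factors of mean \<open>1\<close>.\<close>

lemma L1_norm_product:
  fixes v :: "real ^ 'm::finite" and a :: "real ^ 'l"
  assumes v: "v \<in> V_space" and nn: "\<And>j. v $ j \<ge> - 1"
  shows "L1_norm (product_martingale v a N) = ennreal (norm a)"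
proof -
  interpret digit_space "uniform_count_measure (UNIV :: 'm set)" by (rule digit_space_uniform)
  have P: "P = uniform_cantor" by (simp add: uniform_cantor_def)
  have w: "0 \<le> 1 + v $ j" for j using nn[of j] by linarith
  have "(\<integral>\<^sup>+ x. ennreal (norm (product_martingale v a N n x)) \<partial>uniform_cantor) = ennreal (norm a)" for n
  proof -
    let ?G = "\<lambda>x. \<Prod>i<min n N. 1 + v $ x i"
    have G: "0 \<le> ?G x" for x by (intro prod_nonneg ballI w)
    have "norm (product_martingale v a N n x) = ?G x * norm a" for x
      using G[of x] by (simp add: product_martingale_def)
    then have "(\<integral>\<^sup>+ x. ennreal (norm (product_martingale v a N n x)) \<partial>uniform_cantor)
        = (\<integral>\<^sup>+ x. ennreal (?G x * norm a) \<partial>P)" by (simp add: P)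
    also have "\<dots> = ennreal (LINT x|P. ?G x * norm a)"
      by (intro nn_integral_eq_integral integrable_mult_left integrable_prod_digits)
         (auto intro!: mult_nonneg_nonneg G)
    also have "(LINT x|P. ?G x * norm a) = norm a"
      by (subst integral_mult_left_zero, subst integral_prod_digits) (simp add: integral_weight[OF v])
    finally show ?thesis .
  qed
  then show ?thesis by (simp add: L1_norm_def)
qed

lemma diff_string_product:
  fixes v :: "real ^ 'm::finite" and a :: "real ^ 'l"
  shows "diff_string (product_martingale v a N) n {y. \<forall>i<n. y i = x i}
    = (if n < N then (\<Prod>i<n. 1 + v $ x i) else 0) *\<^sub>R tensor v a"
proof -
  let ?F = "product_martingale v a N"
  let ?c = "if n < N then (\<Prod>i<n. 1 + v $ x i) else 0"
  have "the_elem ((\<lambda>y. ?F (Suc n) y - ?F n y) ` kid n {y. \<forall>i<n. y i = x i} j) = ?c *\<^sub>R (v $ j *\<^sub>R a)" for j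
  proof -
    have "?F (Suc n) y - ?F n y = ?c *\<^sub>R (v $ j *\<^sub>R a)" if "y \<in> kid n {y. \<forall>i<n. y i = x i} j" for y
    proof -
      have y: "\<And>i. i < n \<Longrightarrow> y i = x i" "y n = j" using that by (auto simp: kid_def)
      then have "(\<Prod>i<n. 1 + v $ y i) = (\<Prod>i<n. 1 + v $ x i)" by (intro prod.cong) auto
      then show ?thesis
        using y by (simp add: product_martingale_def min_def algebra_simps)
    qed
    moreover have "x(n := j) \<in> kid n {y. \<forall>i<n. y i = x i} j" by (simp add: kid_def)
    ultimately have "(\<lambda>y. ?F (Suc n) y - ?F n y) ` kid n {y. \<forall>i<n. y i = x i} j
        = {?c *\<^sub>R (v $ j *\<^sub>R a)}" by (intro equalityI image_subsetI) (auto intro!: rev_image_eqI)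
    then show ?thesis by simp
  qed
  then show ?thesis by (simp add: diff_string_def tensor_def vec_eq_iff)
qed

lemma product_in_W_martingales:
  fixes W :: "((real ^ 'l) ^ 'm::finite) set"
  assumes W: "subspace W" and v: "v \<in> M_set W" and va: "tensor v a \<in> W"
  shows "product_martingale v a N \<in> W_martingales W"
proof -
  have V: "v \<in> V_space" and nn: "\<And>j. v $ j \<ge> - 1" using v by (auto simp: M_set_def)
  have "diff_string (product_martingale v a N) n \<omega> \<in> W" if "\<omega> \<in> atoms n" for n \<omega>
  proof -
    obtain x where "\<omega> = {y. \<forall>i<n. y i = x i}" using \<open>\<omega> \<in> atoms n\<close> by (auto simp: atoms_def)
    then show ?thesis using diff_string_product[of v a N n x] subspace_scale[OF W va] by simp
  qed
  then show ?thesis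
    using martingale_product[OF V, of a N] L1_norm_product[OF V nn, of a N]
    by (simp add: W_martingales_def)
qed

lemma simple_product:
  assumes "v \<in> V_space"
  shows "simple_martingale (product_martingale v a N)"
proof -
  have "\<forall>n\<ge>N. product_martingale v a N n = product_martingale v a N N"
    by (simp add: product_martingale_def fun_eq_iff)
  then show ?thesis using martingale_product[OF assms] unfolding simple_martingale_def by blast
qed

text \<open>A sequence lies in exactly one atom of each level, and in exactly one kid of that atom.\<close>

lemma riesz_potential_along_branch:
  fixes \<phi> :: "(real ^ 'l) ^ 'm \<Rightarrow> real ^ 'm::finite"
  shows "riesz_potential \<alpha> \<phi> F x = (\<Sum>n. real CARD('m) powr (- \<alpha> * real n)
    * \<phi> (diff_string F n {y. \<forall>i<n. y i = x i}) $ x n)"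
proof -
  have "(\<Sum>\<omega>\<in>atoms n. \<Sum>j\<in>UNIV. \<phi> (diff_string F n \<omega>) $ j * indicator (kid n \<omega> j) x)
      = \<phi> (diff_string F n {y. \<forall>i<n. y i = x i}) $ x n" for n
  proof -
    let ?\<omega> = "{y. \<forall>i<n. y i = x i}"
    have in_atom: "x \<in> \<omega> \<longleftrightarrow> \<omega> = ?\<omega>" if "\<omega> \<in> atoms n" for \<omega>
      using that by (auto simp: atoms_def)
    have "(\<Sum>\<omega>\<in>atoms n. \<Sum>j\<in>UNIV. \<phi> (diff_string F n \<omega>) $ j * indicator (kid n \<omega> j) x)
        = (\<Sum>\<omega>\<in>atoms n. if \<omega> = ?\<omega> then \<phi> (diff_string F n \<omega>) $ x n else 0)"
    proof (rule sum.cong[OF refl])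
      fix \<omega> :: "(nat \<Rightarrow> 'm) set" assume w: "\<omega> \<in> atoms n"
      have "(\<Sum>j\<in>UNIV. \<phi> (diff_string F n \<omega>) $ j * indicator (kid n \<omega> j) x)
          = (\<Sum>j\<in>UNIV. if x n = j then (if x \<in> \<omega> then \<phi> (diff_string F n \<omega>) $ j else 0) else 0)"
        by (intro sum.cong) (auto simp: kid_def)
      then show "(\<Sum>j\<in>UNIV. \<phi> (diff_string F n \<omega>) $ j * indicator (kid n \<omega> j) x)
          = (if \<omega> = ?\<omega> then \<phi> (diff_string F n \<omega>) $ x n else 0)"
        by (simp add: in_atom[OF w])
    qed
    also have "\<dots> = \<phi> (diff_string F n ?\<omega>) $ x n"
      using finite_atoms[where n = n, where 'm = 'm] by (subst sum.delta) (auto simp: atoms_def)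
    finally show ?thesis .
  qed
  then show ?thesis by (simp add: riesz_potential_def)
qed

lemma riesz_potential_product:
  fixes v :: "real ^ 'm::finite" and a :: "real ^ 'l"
  assumes \<phi>: "linear_between W V_space \<phi>" and va: "tensor v a \<in> W"
  shows "riesz_potential \<alpha> \<phi> (product_martingale v a N) x
    = (\<Sum>n<N. real CARD('m) powr (- \<alpha> * real n) * (\<Prod>i<n. 1 + v $ x i) * \<phi> (tensor v a) $ x n)"
proof -
  have scale: "\<phi> (c *\<^sub>R tensor v a) = c *\<^sub>R \<phi> (tensor v a)" for c
    using \<phi> va by (simp add: linear_between_def)
  have "riesz_potential \<alpha> \<phi> (product_martingale v a N) x
      = (\<Sum>n. real CARD('m) powr (- \<alpha> * real n)
          * ((if n < N then (\<Prod>i<n. 1 + v $ x i) else 0) * \<phi> (tensor v a) $ x n))"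
    by (simp only: riesz_potential_along_branch diff_string_product scale vector_scaleR_component)
       simp
  also have "\<dots> = (\<Sum>n<N. real CARD('m) powr (- \<alpha> * real n)
          * ((if n < N then (\<Prod>i<n. 1 + v $ x i) else 0) * \<phi> (tensor v a) $ x n))"
    by (rule suminf_finite) auto
  also have "\<dots> = (\<Sum>n<N. real CARD('m) powr (- \<alpha> * real n) * (\<Prod>i<n. 1 + v $ x i) * \<phi> (tensor v a) $ x n)"
    by (intro sum.cong) auto
  finally show ?thesis .
qed

section \<open>Necessity of cancellation\<close>

theorem proposition5p6:
  fixes W :: "((real ^ 'l) ^ 'm::finite) set"
    and \<phi> :: "(real ^ 'l) ^ 'm \<Rightarrow> real ^ 'm"
    and \<alpha> :: real
  assumes "CARD('m) \<ge> 2"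
    and "subspace W" and "W \<subseteq> V_tensor"
    and "geometric W"
    and "\<alpha> = - left_deriv (kappa W) 1 / ln (real CARD('m))"
    and "0 < \<alpha>" and "\<alpha> < 1"
    and "linear_between W V_space \<phi>"
    and "\<exists>C::real. \<forall>F \<in> W_martingales W. simple_martingale F \<longrightarrow>
           (\<forall>\<nu> :: (nat \<Rightarrow> 'm) measure.
              finite_measure \<nu> \<longrightarrow> sets \<nu> = sets cantor_borel \<longrightarrow>
              (SUP n. SUP \<omega>\<in>atoms n.
                 ennreal (real CARD('m) powr ((1 - \<alpha>) * real n)) * emeasure \<nu> \<omega>) < \<infinity> \<longrightarrow>
              (\<integral>\<^sup>+ x. ennreal \<bar>riesz_potential \<alpha> \<phi> F x\<bar> \<partial>\<nu>)
                \<le> ennreal C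
                   * (SUP n. SUP \<omega>\<in>atoms n.
                        ennreal (real CARD('m) powr ((1 - \<alpha>) * real n)) * emeasure \<nu> \<omega>)
                   * L1_norm F)"
  shows "canceling W \<alpha> \<phi>"
proof -
  let ?m = "real CARD('m)"
  obtain C where C: "\<And>F \<nu>. F \<in> W_martingales W \<Longrightarrow> simple_martingale F \<Longrightarrow>
      finite_measure \<nu> \<Longrightarrow> sets \<nu> = sets cantor_borel \<Longrightarrow>
      (SUP n. SUP \<omega>\<in>atoms n. ennreal (?m powr ((1 - \<alpha>) * real n)) * emeasure \<nu> \<omega>) < \<infinity> \<Longrightarrow>
      (\<integral>\<^sup>+ x. ennreal \<bar>riesz_potential \<alpha> \<phi> F x\<bar> \<partial>\<nu>)
        \<le> ennreal C * (SUP n. SUP \<omega>\<in>atoms n. ennreal (?m powr ((1 - \<alpha>) * real n)) * emeasure \<nu> \<omega>)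
           * L1_norm F"
    using assms(9) by blast
  have m: "?m > 0" using assms(1) by linarith
  have "\<phi> (tensor v a) $ j = 0" if ext: "extremal W \<alpha> v a" and j: "j \<in> support v" for v a j
  proof -
    let ?H = "support v" and ?b = "\<lambda>j. \<phi> (tensor v a) $ j"
    have va: "tensor v a \<in> W" and v: "v \<in> M_set W" using ext by (auto simp: extremal_def)
    then have V: "v \<in> V_space" and nn: "\<And>j. v $ j \<ge> - 1" by (auto simp: M_set_def)
    note weight = extremal_weight[OF assms(1,2,4,5) ext]
    have card: "real (card ?H) = ?m powr (1 - \<alpha>)"
      by (rule card_support_extremal[OF assms(1,2,4,5) ext])
    have H: "?H \<noteq> {}" "finite ?H" using j by auto
    define p where "p = pmf_of_set ?H"
    have set_p: "set_pmf p = ?H" using H by (simp add: p_def)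
    interpret digit_space "measure_pmf p" by (rule digit_space_pmf)
    let ?D = "SUP n. SUP \<omega>\<in>atoms n. ennreal (?m powr ((1 - \<alpha>) * real n)) * emeasure P \<omega>"
    have "ennreal (?m powr ((1 - \<alpha>) * real n)) * emeasure P \<omega> \<le> 1" if "\<omega> \<in> atoms n" for n \<omega>
    proof -
      obtain x where x: "\<omega> = {y. \<forall>i<n. y i = x i}" using \<open>\<omega> \<in> atoms n\<close> by (auto simp: atoms_def)
      have "emeasure (measure_pmf p) {x i} \<le> ennreal (1 / card ?H)" for i
        using H by (simp add: emeasure_pmf_single p_def indicator_def ennreal_leI)
      then have "emeasure P \<omega> \<le> (\<Prod>i<n. ennreal (1 / card ?H))"
        unfolding x emeasure_atom by (intro prod_mono_ennreal)
      also have "\<dots> = ennreal ((1 / card ?H) ^ n)" by (simp add: ennreal_power)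
      finally have "ennreal (?m powr ((1 - \<alpha>) * real n)) * emeasure P \<omega>
          \<le> ennreal (?m powr ((1 - \<alpha>) * real n)) * ennreal ((1 / card ?H) ^ n)"
        by (intro mult_left_mono) auto
      also have "\<dots> = ennreal (card ?H ^ n * (1 / card ?H) ^ n)"
        using m by (simp add: card ennreal_mult[symmetric] powr_powr[symmetric] powr_realpow)
      also have "card ?H ^ n * (1 / card ?H) ^ n = (1::real)"
        using H by (simp add: power_mult_distrib[symmetric])
      finally show ?thesis by simp
    qed
    then have D: "?D \<le> 1" by (intro SUP_least)
    \<comment> \<open>Almost every sequence has all digits in \<open>H\<close>, where the weights and the powers of \<open>m\<close> cancel.\<close>
    have walk: "AE x in P. riesz_potential \<alpha> \<phi> (product_martingale v a N) x = (\<Sum>n<N. ?b (x n))" for N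
    proof -
      have "AE x in P. x n \<in> ?H" for n
        by (rule AE_PiM_component) (auto simp: AE_measure_pmf_iff set_p intro: measure_pmf.prob_space_axioms)
      then have "AE x in P. \<forall>n. x n \<in> ?H" by (simp add: AE_all_countable)
      then show ?thesis
      proof eventually_elim
        case (elim x)
        have "?m powr (- \<alpha> * real n) * (\<Prod>i<n. 1 + v $ x i) = 1" for n
        proof -
          have "(\<Prod>i<n. 1 + v $ x i) = (?m powr \<alpha>) ^ n" using elim weight by simp
          also have "\<dots> = ?m powr (\<alpha> * real n)"
            using m by (simp add: powr_powr[symmetric] powr_realpow)
          finally show ?thesis using m by (simp add: powr_add[symmetric])
        qed
        then show ?case by (simp add: riesz_potential_product[OF assms(8) va])
      qed
    qed
    \<comment> \<open>The constant \<open>C\<close> may be negative, and then \<open>ennreal C = 0\<close>; hence the maximum with \<open>0\<close>.\<close>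
    have "(\<integral>\<^sup>+ x. ennreal \<bar>\<Sum>n<N. ?b (x n)\<bar> \<partial>P) \<le> ennreal (max C 0 * norm a)" for N
    proof -
      let ?F = "product_martingale v a N"
      have "(\<integral>\<^sup>+ x. ennreal \<bar>\<Sum>n<N. ?b (x n)\<bar> \<partial>P) = (\<integral>\<^sup>+ x. ennreal \<bar>riesz_potential \<alpha> \<phi> ?F x\<bar> \<partial>P)"
        using walk[of N] by (intro nn_integral_cong_AE) auto
      also have "\<dots> \<le> ennreal C * ?D * L1_norm ?F"
        by (rule C[OF product_in_W_martingales[OF assms(2) v va] simple_product[OF V] _ sets_P])
           (use D in \<open>auto intro: P.finite_measure_axioms order.strict_trans1[OF D]\<close>)
      also have "\<dots> \<le> ennreal C * 1 * ennreal (norm a)"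
        unfolding L1_norm_product[OF V nn] by (intro mult_mono D) auto
      also have "\<dots> \<le> ennreal (max C 0 * norm a)"
        by (simp add: ennreal_mult max_def ennreal_neg)
      finally show ?thesis .
    qed
    then show ?thesis
      by (rule bounded_random_walk_trivial) (use j in \<open>auto simp: set_p\<close>)
  qed
  then show ?thesis by (auto simp: canceling_def)
qed

end
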